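(* Let $k\in\mathbb{N}$ and let $f_1,\dots,f_k\in\mathbb{Z}[x]$ be polynomials with $f_i(0)=0$ for each $i$. Then for any finite coloring of $\mathbb{Z}$ there exist $x_0,x_1,\dots,x_k,a_1,a_2,\dots,a_k\in\mathbb{Z}\setminus\{0\}$, all with the same color, satisfying $$a_i-x_i=f_i(x_{i-1})\qquad\text{for every } i=1,\dots,k.$$
   Context: $\mathbb{N}=\{1,2,\dots\}$. *)

theory Defs
  imports "HOL-Computational_Algebra.Polynomial"
begin

end

theory Submission
  imports Defs "HOL-Library.Multiset_Order" "HOL-Library.FuncSet"
begin

text \<open>Call a set \<open>E\<close> of positive integers \<open>f\<close>-free if it contains no \<open>x, y, y + f(x)\<close>. If the
  points \<open>x \<in> E\<close> admitting \<open>y, y + f(x) \<in> E\<close> are deleted from \<open>E\<close>, the rest is \<open>f\<close>-free. Deleting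
  these free remainders from a colour class for \<open>f\<^sub>k, \<dots>, f\<^sub>1\<close> in turn leaves starting points of
  the required chains, so the theorem follows once the positive integers are not a finite union
  of sets, each free for its own polynomial. For this, take a minimal set \<open>S\<close> of colours whose
  union \<open>T\<close> is thick. By minimality every colour of \<open>S\<close> occurs with bounded gaps in every long
  interval inside \<open>T\<close>, so each position can be recoloured by the distances to the next points of
  all these colours. The polynomial van der Waerden theorem with parameter \<open>x \<in> T\<close>, proved by colour
  focusing and PET induction, applied to this new colouring gives \<open>y\<close> and \<open>y + f(x)\<close> in the same
  class as \<open>x\<close>, whichever colour \<open>x\<close> has.\<close>

section \<open>The weight of a finite set of polynomials\<close>

definition lead_coeffs :: "int poly set \<Rightarrow> nat \<Rightarrow> int set" where
  "lead_coeffs A n = lead_coeff ` {p \<in> A. degree p = n}"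

text \<open>The PET weight vector: degree \<open>n\<close> occurs once per distinct leading
  coefficient at \<open>n\<close>. As a multiset it inherits a well-founded order, decided by the
  highest degree at which two weights differ.\<close>

definition weight :: "int poly set \<Rightarrow> nat multiset" where
  "weight A = (\<Sum>n\<in>degree ` A. replicate_mset (card (lead_coeffs A n)) n)"

lemma finite_lead_coeffs: "finite A \<Longrightarrow> finite (lead_coeffs A n)"
  by (simp add: lead_coeffs_def)

lemma count_weight:
  assumes "finite A"
  shows "count (weight A) n = card (lead_coeffs A n)"
proof -
  have "lead_coeffs A n = {}" if "n \<notin> degree ` A"
    using that by (auto simp: lead_coeffs_def)
  then show ?thesis
    using assms by (auto simp: weight_def count_sum)
qed

text \<open>The displacement that turns \<open>a + p e\<close> into the point with parameter
  \<open>x + e\<close> seen from the focus moved by \<open>- g x\<close>. Subtracting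
  \<open>poly p e\<close> keeps the value at 0 zero if \<open>g\<close> vanishes there.\<close>

definition poly_shift :: "int poly \<Rightarrow> int \<Rightarrow> int poly \<Rightarrow> int poly" where
  "poly_shift g e p = p \<circ>\<^sub>p [:e, 1:] - [:poly p e:] - g"

lemma poly_poly_shift: "poly (poly_shift g e p) x = poly p (x + e) - poly p e - poly g x"
  by (simp add: poly_shift_def poly_pcompose add.commute)

lemma coeff_poly_shift:
  "n > 0 \<Longrightarrow> coeff (poly_shift g e p) n = coeff (p \<circ>\<^sub>p [:e, 1:]) n - coeff g n"
  by (cases n) (auto simp: poly_shift_def)

lemma lead_coeff_pcompose_shift: "coeff (p \<circ>\<^sub>p [:e, 1:]) (degree p) = lead_coeff (p :: int poly)"
  using lead_coeff_comp[of "[:e, 1:]" p] by (simp add: degree_pcompose)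

lemma coeff_pcompose_shift_eq_0: "n > degree p \<Longrightarrow> coeff (p \<circ>\<^sub>p [:e, 1:]) n = (0 :: int)"
  by (rule coeff_eq_0) (simp add: degree_pcompose)

lemma degree_poly_shift:
  assumes "degree g < degree p"
  shows "degree (poly_shift g e p) = degree p"
proof (rule antisym)
  show "degree (poly_shift g e p) \<le> degree p"
  proof (rule degree_le, safe)
    fix i assume "degree p < i"
    then show "coeff (poly_shift g e p) i = 0"
      using assms by (simp add: coeff_poly_shift coeff_pcompose_shift_eq_0 coeff_eq_0)
  qed
  have "p \<noteq> 0" using assms by auto
  then have "coeff (poly_shift g e p) (degree p) \<noteq> 0"
    using assms by (simp add: coeff_poly_shift lead_coeff_pcompose_shift coeff_eq_0)
  then show "degree p \<le> degree (poly_shift g e p)"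
    by (rule le_degree)
qed

text \<open>Above \<open>degree g\<close> shifting keeps degree and leading coefficient. At
  \<open>degree g\<close> the leading coefficients drop by that of \<open>g\<close>, and the one
  equal to it cancels. Lower degrees may gain, which the order ignores.\<close>

lemma weight_poly_shift_less:
  assumes A: "finite A" and E: "finite E" and g: "g \<in> A" "degree g > 0"
    and min: "\<And>p. p \<in> A \<Longrightarrow> degree g \<le> degree p"
  shows "weight ((\<Union>e\<in>E. poly_shift g e ` A) - {0}) < weight A"
proof -
  define B where "B = (\<Union>e\<in>E. poly_shift g e ` A) - {0}"
  have finB: "finite B" using A E by (auto simp: B_def)
  have above: "lead_coeffs B n \<subseteq> lead_coeffs A n" if n: "n > degree g" for n
  proof
    fix c assume "c \<in> lead_coeffs B n"
    then obtain p e where p: "p \<in> A" "degree (poly_shift g e p) = n" "c = lead_coeff (poly_shift g e p)"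
      by (auto simp: lead_coeffs_def B_def)
    have "coeff (poly_shift g e p) n \<noteq> 0"
      using p(2) n by (metis leading_coeff_0_iff degree_0 not_less0)
    then have "n \<le> degree p"
      using n by (auto simp: coeff_poly_shift coeff_eq_0 coeff_pcompose_shift_eq_0 intro: leI)
    then have "degree p = n" using degree_poly_shift[of g p e] n p(2) by simp
    moreover have "c = lead_coeff p"
      using p n calculation lead_coeff_pcompose_shift[of p e] by (simp add: coeff_poly_shift coeff_eq_0)
    ultimately show "c \<in> lead_coeffs A n" using p(1) by (auto simp: lead_coeffs_def)
  qed
  have "lead_coeffs B (degree g) \<subseteq>
      (\<lambda>c. c - lead_coeff g) ` (lead_coeffs A (degree g) - {lead_coeff g})"
  proof
    fix c assume "c \<in> lead_coeffs B (degree g)"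
    then obtain p e where p: "p \<in> A" "degree (poly_shift g e p) = degree g"
      "c = lead_coeff (poly_shift g e p)" "poly_shift g e p \<noteq> 0"
      by (auto simp: lead_coeffs_def B_def)
    have deg: "degree p = degree g"
      using min[OF p(1)] degree_poly_shift[of g p e] p(2) by linarith
    have "c = lead_coeff p - lead_coeff g"
      using p(2,3) g(2) deg lead_coeff_pcompose_shift[of p e] by (simp add: coeff_poly_shift)
    moreover have "c \<noteq> 0" using p(3,4) by simp
    ultimately show "c \<in> (\<lambda>c. c - lead_coeff g) ` (lead_coeffs A (degree g) - {lead_coeff g})"
      using p(1) deg by (auto simp: lead_coeffs_def)
  qed
  then have "card (lead_coeffs B (degree g)) \<le> card (lead_coeffs A (degree g) - {lead_coeff g})"
    by (rule surj_card_le[rotated]) (simp add: A finite_lead_coeffs)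
  also have "\<dots> < card (lead_coeffs A (degree g))"
    by (rule card_Diff1_less) (use A g in \<open>auto simp: finite_lead_coeffs lead_coeffs_def\<close>)
  finally have at: "count (weight B) (degree g) < count (weight A) (degree g)"
    by (simp add: count_weight A finB)
  have "count (weight B) n \<le> count (weight A) n" if "n > degree g" for n
    by (simp add: count_weight A finB card_mono finite_lead_coeffs above that)
  with at have "weight B < weight A"
    unfolding less_multiset\<^sub>H\<^sub>O by (metis linorder_neqE_nat not_le order.strict_iff_not)
  then show ?thesis by (simp add: B_def)
qed

section \<open>Polynomial van der Waerden with the parameter in a thick set\<close>

definition thick :: "int set \<Rightarrow> bool" where
  "thick T \<longleftrightarrow> (\<forall>n. \<exists>u. {u..u + int n} \<subseteq> T)"

lemma thick_nonempty: "thick T \<Longrightarrow> \<exists>t. t \<in> T"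
  unfolding thick_def by (metis atLeastAtMost_iff order_refl of_nat_0_le_iff le_add_same_cancel1 subsetD)

text \<open>Cut \<open>b\<close>, a bound for all shifts, off both ends of a long interval.\<close>

lemma thick_shift:
  assumes "thick T" "finite X"
  shows "thick {t \<in> T. \<forall>x\<in>X. t + x \<in> T}"
  unfolding thick_def
proof
  fix n
  define b where "b = (\<Sum>x\<in>X. \<bar>x\<bar>)"
  have b: "\<bar>x\<bar> \<le> b" if "x \<in> X" for x
    unfolding b_def using that assms(2) by (intro member_le_sum) auto
  have "b \<ge> 0" by (simp add: b_def sum_nonneg)
  obtain u where u: "{u..u + int (n + 2 * nat b)} \<subseteq> T"
    using assms(1) unfolding thick_def by blast
  have "{u + b..u + b + int n} \<subseteq> {t \<in> T. \<forall>x\<in>X. t + x \<in> T}"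
  proof (clarify, intro conjI ballI)
    fix t assume t: "t \<in> {u + b..u + b + int n}"
    show "t \<in> T" using t \<open>b \<ge> 0\<close> by (intro subsetD[OF u]) auto
    fix x assume "x \<in> X"
    then show "t + x \<in> T" using b[of x] t \<open>b \<ge> 0\<close> by (intro subsetD[OF u]) auto
  qed
  then show "\<exists>u. {u..u + int n} \<subseteq> {t \<in> T. \<forall>x\<in>X. t + x \<in> T}" by blast
qed

text \<open>\<open>W\<close> and \<open>X\<close> precede the colouring, so that finite windows can
  be fixed first and then coloured by their patterns. Colours are natural numbers;
  \<open>poly_vdWE\<close> passes to any finite palette.\<close>

definition poly_vdW :: "int poly set \<Rightarrow> bool" where
  "poly_vdW A \<longleftrightarrow> (\<forall>T (K :: nat set). thick T \<and> T \<subseteq> {0<..} \<and> finite K \<longrightarrow>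
     (\<exists>W X. finite W \<and> finite X \<and> X \<subseteq> T \<and>
       (\<forall>\<chi>. range \<chi> \<subseteq> K \<longrightarrow> (\<exists>a\<in>W. \<exists>x\<in>X. \<forall>p\<in>A. \<chi> (a + poly p x) = \<chi> a))))"

lemma poly_vdWE:
  fixes R :: "'b set"
  assumes "poly_vdW A" "thick T" "T \<subseteq> {0<..}" "finite R"
  obtains W X where "finite W" "finite X" "X \<subseteq> T"
    "\<forall>\<chi> :: int \<Rightarrow> 'b. range \<chi> \<subseteq> R \<longrightarrow> (\<exists>a\<in>W. \<exists>x\<in>X. \<forall>p\<in>A. \<chi> (a + poly p x) = \<chi> a)"
proof -
  obtain h :: "'b \<Rightarrow> nat" where h: "inj_on h R"
    using finite_imp_inj_to_nat_seg[OF assms(4)] by blast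
  obtain W X where WX: "finite W" "finite X" "X \<subseteq> T"
    "\<And>\<chi>. range \<chi> \<subseteq> h ` R \<Longrightarrow> \<exists>a\<in>W. \<exists>x\<in>X. \<forall>p\<in>A. \<chi> (a + poly p x) = \<chi> a"
    using assms unfolding poly_vdW_def by (metis finite_imageI)
  show thesis
  proof (rule that[OF WX(1-3)], intro allI impI)
    fix \<chi> :: "int \<Rightarrow> 'b" assume "range \<chi> \<subseteq> R"
    then have "range (h \<circ> \<chi>) \<subseteq> h ` R" and mem: "\<And>z. \<chi> z \<in> R" by auto
    from WX(4)[OF this(1)] show "\<exists>a\<in>W. \<exists>x\<in>X. \<forall>p\<in>A. \<chi> (a + poly p x) = \<chi> a"
      using inj_onD[OF h] mem by (metis comp_apply)
  qed
qed

text \<open>Each \<open>s\<close> in \<open>S\<close> is a spoke at the focus \<open>a\<close>: its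
  points share one colour, and distinct spokes differ. For \<open>g\<close> in \<open>A\<close>, the
  point \<open>a + poly g s\<close> represents that colour.\<close>

definition focused :: "int poly set \<Rightarrow> int poly \<Rightarrow> (int \<Rightarrow> nat) \<Rightarrow> int \<Rightarrow> int set \<Rightarrow> bool" where
  "focused A g \<chi> a S \<longleftrightarrow> (\<forall>s\<in>S. \<forall>p\<in>A. \<chi> (a + poly p s) = \<chi> (a + poly g s)) \<and>
     inj_on (\<lambda>s. \<chi> (a + poly g s)) S"

text \<open>Each round adds one spoke. The hypothesis on shifted polynomials, applied to window
  patterns, displaces the old spokes without recolouring them so that they meet at a new focus; the
  old focus then supplies one more spoke.\<close>

lemma focusing_step:
  assumes T: "thick T" "T \<subseteq> {0<..}" and K: "finite (K :: nat set)"
    and A: "finite A" "g \<in> A" "\<forall>p\<in>A. poly p 0 = 0"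
    and IH: "\<forall>E. finite E \<longrightarrow> poly_vdW ((\<Union>e\<in>E. poly_shift g e ` A) - {0})"
  shows "\<exists>W X. finite W \<and> finite X \<and> X \<subseteq> T \<and> (\<forall>\<chi>. range \<chi> \<subseteq> K \<longrightarrow>
     (\<exists>a\<in>W. \<exists>x\<in>X. \<forall>p\<in>A. \<chi> (a + poly p x) = \<chi> a) \<or>
     (\<exists>a\<in>W. \<exists>S\<subseteq>X. card S = q \<and> focused A g \<chi> a S))"
proof (induction q)
  case 0
  show ?case
    by (rule exI[of _ "{0}"], rule exI[of _ "{}"]) (auto simp: focused_def)
next
  case (Suc q)
  from Suc.IH obtain W X where WX: "finite W" "finite X" "X \<subseteq> T"
    and foc: "\<forall>\<chi>. range \<chi> \<subseteq> K \<longrightarrow> (\<exists>a\<in>W. \<exists>x\<in>X. \<forall>p\<in>A. \<chi> (a + poly p x) = \<chi> a) \<or>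
     (\<exists>a\<in>W. \<exists>S\<subseteq>X. card S = q \<and> focused A g \<chi> a S)"
    by (elim exE conjE) (rule that)
  \<comment> \<open>Old spokes will get the parameter \<open>t + x\<close>, which must stay in
    \<open>T\<close>.\<close>
  define T' where "T' = {t \<in> T. \<forall>x\<in>X. t + x \<in> T}"
  \<comment> \<open>All points that the conclusion for \<open>q\<close> inspects; a position is
    recoloured by the pattern on its translate of \<open>B\<close>.\<close>
  define B where "B = W \<union> (\<Union>a\<in>W. \<Union>p\<in>A. \<Union>x\<in>X. {a + poly p x})"
  have "finite B" using WX A by (auto simp: B_def)
  then have fin: "finite (B \<rightarrow>\<^sub>E K)" using K by (intro finite_PiE) auto
  \<comment> \<open>The shift \<open>e = 0\<close> gives \<open>p - g\<close> and serves the old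
    focus; \<open>e\<close> in \<open>X\<close> serves the old spokes.\<close>
  have vdW: "poly_vdW ((\<Union>e\<in>insert 0 X. poly_shift g e ` A) - {0})" (is "poly_vdW ?A'")
    by (rule IH[rule_format]) (simp add: WX)
  have T': "thick T'" "T' \<subseteq> {0<..}"
    using thick_shift T WX(2) by (auto simp: T'_def)
  obtain W' X' where W'X': "finite W'" "finite X'" "X' \<subseteq> T'"
    and rec: "\<forall>\<psi> :: int \<Rightarrow> int \<Rightarrow> nat. range \<psi> \<subseteq> (B \<rightarrow>\<^sub>E K) \<longrightarrow>
      (\<exists>a\<in>W'. \<exists>x\<in>X'. \<forall>p\<in>?A'. \<psi> (a + poly p x) = \<psi> a)"
    by (rule poly_vdWE[OF vdW T' fin])
  define X2 where "X2 = X \<union> X' \<union> (\<Union>x\<in>X'. (+) x ` X)"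
  \<comment> \<open>Old foci, for configurations already complete, and foci moved by
    \<open>- g x\<close>.\<close>
  define W2 where "W2 = (\<Union>a'\<in>W'. \<Union>a\<in>W. insert (a' + a) ((\<lambda>x. a' + a - poly g x) ` X'))"
  have X2: "finite X2" "X2 \<subseteq> T" and W2: "finite W2"
    using WX W'X' by (auto simp: X2_def W2_def T'_def)
  have "(\<exists>a\<in>W2. \<exists>x\<in>X2. \<forall>p\<in>A. \<chi> (a + poly p x) = \<chi> a) \<or>
     (\<exists>a\<in>W2. \<exists>S\<subseteq>X2. card S = Suc q \<and> focused A g \<chi> a S)" if \<chi>: "range \<chi> \<subseteq> K" for \<chi>
  proof -
    define \<psi> where "\<psi> z = restrict (\<lambda>b. \<chi> (z + b)) B" for z
    have "range \<psi> \<subseteq> (B \<rightarrow>\<^sub>E K)" using \<chi> by (auto simp: \<psi>_def)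
    then obtain a' x where a': "a' \<in> W'" and x: "x \<in> X'"
      and eq: "\<forall>p\<in>?A'. \<psi> (a' + poly p x) = \<psi> a'"
      using rec by (elim allE[of _ \<psi>] impE bexE) (assumption, rule that)
    have copy: "\<chi> (a' + (poly p (x + e) - poly p e - poly g x) + b) = \<chi> (a' + b)"
      if "p \<in> A" "e \<in> insert 0 X" "b \<in> B" for p e b
    proof -
      have "\<psi> (a' + poly (poly_shift g e p) x) = \<psi> a'"
      proof (cases "poly_shift g e p = 0")
        case False
        then have "poly_shift g e p \<in> ?A'" using that(1,2) by blast
        then show ?thesis by (rule bspec[OF eq])
      qed simp
      then have "\<psi> (a' + poly (poly_shift g e p) x) b = \<psi> a' b" by (rule arg_cong)
      then show ?thesis
        using \<open>b \<in> B\<close> by (simp add: \<psi>_def poly_poly_shift)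
    qed
    have "range (\<lambda>z. \<chi> (a' + z)) \<subseteq> K" using \<chi> by auto
    from foc[rule_format, OF this] show ?thesis
    proof
      assume "\<exists>a\<in>W. \<exists>x\<in>X. \<forall>p\<in>A. \<chi> (a' + (a + poly p x)) = \<chi> (a' + a)"
      then obtain a y where "a \<in> W" "y \<in> X" "\<forall>p\<in>A. \<chi> ((a' + a) + poly p y) = \<chi> (a' + a)"
        by (auto simp: add.assoc)
      moreover have "a' + a \<in> W2" "y \<in> X2" using calculation a' by (auto simp: W2_def X2_def)
      ultimately show ?thesis by blast
    next
      assume "\<exists>a\<in>W. \<exists>S\<subseteq>X. card S = q \<and> focused A g (\<lambda>z. \<chi> (a' + z)) a S"
      then obtain a S where a: "a \<in> W" and S: "S \<subseteq> X" "card S = q"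
        and mono: "\<And>s p. s \<in> S \<Longrightarrow> p \<in> A \<Longrightarrow> \<chi> (a' + (a + poly p s)) = \<chi> (a' + (a + poly g s))"
        and inj: "inj_on (\<lambda>s. \<chi> (a' + (a + poly g s))) S"
        unfolding focused_def by blast
      have aW2: "a' + a \<in> W2" using a a' by (auto simp: W2_def)
      show ?thesis
      \<comment> \<open>A spoke in the colour of the focus completes a configuration; otherwise the
        focus has a new colour.\<close>
      proof (cases "\<exists>s\<in>S. \<chi> (a' + (a + poly g s)) = \<chi> (a' + a)")
        case True
        then obtain s where "s \<in> S" "\<forall>p\<in>A. \<chi> (a' + a + poly p s) = \<chi> (a' + a)"
          using mono by (metis add.assoc)
        moreover have "s \<in> X2" using calculation S by (auto simp: X2_def)
        ultimately show ?thesis using aW2 by blast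
      next
        case False
        define c where "c = a' + a - poly g x" \<comment> \<open>seen from this focus, \<open>p (x + s)\<close> is the point \<open>a + p s\<close>
          of the window displaced by \<open>poly_shift g s p\<close> at \<open>x\<close>\<close>
        have c: "c \<in> W2" using a a' x by (auto simp: W2_def c_def)
        have at_s: "\<chi> (c + poly p (x + s)) = \<chi> (a' + (a + poly p s))" if "s \<in> S" "p \<in> A" for s p
          using copy[of p s "a + poly p s"] that S(1) a
          by (auto simp: B_def c_def algebra_simps)
        have at_0: "\<chi> (c + poly p x) = \<chi> (a' + a)" if "p \<in> A" for p
          using copy[of p 0 a] that a A(3)[rule_format, OF that] by (auto simp: B_def c_def algebra_simps)
        define S2 where "S2 = insert x ((+) x ` S)"
        \<comment> \<open>Positivity of \<open>T\<close> makes \<open>x\<close> differ from every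
          \<open>x + s\<close>.\<close>
        have "0 \<notin> S" using S(1) WX(3) T(2) by auto
        moreover have "finite S" using S WX finite_subset by blast
        ultimately have "card S2 = Suc q"
          unfolding S2_def using S(2) by (subst card_insert_disjoint) (auto simp: card_image)
        moreover have "S2 \<subseteq> X2" using x S(1) by (auto simp: S2_def X2_def)
        moreover have "focused A g \<chi> c S2"
          unfolding focused_def
        proof
          show "\<forall>s\<in>S2. \<forall>p\<in>A. \<chi> (c + poly p s) = \<chi> (c + poly g s)"
          proof (intro ballI)
            fix r p assume "r \<in> S2" "p \<in> A"
            then consider "r = x" | s where "s \<in> S" "r = x + s" by (auto simp: S2_def)
            then show "\<chi> (c + poly p r) = \<chi> (c + poly g r)"
            proof cases
              case 1
              then show ?thesis by (simp only: at_0[OF \<open>p \<in> A\<close>] at_0[OF A(2)])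
            next
              case 2
              then show ?thesis
                by (simp only: at_s[OF _ \<open>p \<in> A\<close>] at_s[OF _ A(2)] mono[OF _ \<open>p \<in> A\<close>])
            qed
          qed
          have "inj_on (\<lambda>s. \<chi> (c + poly g s)) ((+) x ` S)"
          proof (rule inj_onI, clarify)
            fix s t assume "s \<in> S" "t \<in> S" "\<chi> (c + poly g (x + s)) = \<chi> (c + poly g (x + t))"
            then show "x + s = x + t"
              using inj_onD[OF inj, of s t] at_s[OF _ A(2), of s] at_s[OF _ A(2), of t] by simp
          qed
          moreover have "\<chi> (c + poly g x) \<noteq> \<chi> (c + poly g (x + s))" if "s \<in> S" for s
            unfolding at_s[OF that A(2)] at_0[OF A(2)] using False that by metis
          ultimately show "inj_on (\<lambda>s. \<chi> (c + poly g s)) S2"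
            unfolding S2_def by (subst inj_on_insert) auto
        qed
        ultimately show ?thesis using c by blast
      qed
    qed
  qed
  then show ?case using X2 W2 by (intro exI[of _ W2] exI[of _ X2]) blast
qed

text \<open>PET induction: differencing with a \<open>g\<close> of least degree lowers the weight,
  and \<open>Suc (card K)\<close> spokes of distinct colours cannot exist.\<close>

theorem polynomial_van_der_Waerden:
  assumes "finite A" "0 \<notin> A" "\<And>p. p \<in> A \<Longrightarrow> poly p 0 = 0"
  shows "poly_vdW A"
  using assms
proof (induction A rule: measure_induct_rule[of weight])
  case (less A)
  have deg: "degree p > 0" if "p \<in> A" for p
  proof (rule ccontr)
    assume "\<not> degree p > 0"
    then obtain c where "p = [:c:]" by (metis degree_eq_zeroE not_gr_zero)
    then show False using less.prems that by force
  qed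
  show ?case
  proof (cases "A = {}")
    case True
    show ?thesis
      unfolding poly_vdW_def
    proof (intro allI impI)
      fix T :: "int set" and K :: "nat set"
      assume "thick T \<and> T \<subseteq> {0<..} \<and> finite K"
      then obtain t where "t \<in> T" using thick_nonempty by blast
      then show "\<exists>W X. finite W \<and> finite X \<and> X \<subseteq> T \<and>
       (\<forall>\<chi>. range \<chi> \<subseteq> K \<longrightarrow> (\<exists>a\<in>W. \<exists>x\<in>X. \<forall>p\<in>A. \<chi> (a + poly p x) = \<chi> a))"
        by (intro exI[of _ "{0}"] exI[of _ "{t}"]) (simp add: True)
    qed
  next
    case False
    then obtain g where g: "g \<in> A" "\<And>p. p \<in> A \<Longrightarrow> degree g \<le> degree p"
      by (metis ex_min_if_finite less.prems(1) finite_imageI arg_min_if_finite(1) arg_min_least)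
    have IH: "\<forall>E. finite E \<longrightarrow> poly_vdW ((\<Union>e\<in>E. poly_shift g e ` A) - {0})"
      using less.prems g
      by (intro allI impI less.IH weight_poly_shift_less deg) (auto simp: poly_poly_shift)
    show ?thesis
      unfolding poly_vdW_def
    proof (intro allI impI)
      fix T :: "int set" and K :: "nat set"
      assume TK: "thick T \<and> T \<subseteq> {0<..} \<and> finite K"
      have "\<not> (card S = Suc (card K) \<and> focused A g \<chi> a S)" if "range \<chi> \<subseteq> K" for \<chi> a S
      proof
        assume S: "card S = Suc (card K) \<and> focused A g \<chi> a S"
        then have "card S \<le> card K"
          using that TK by (intro card_inj_on_le[of "\<lambda>s. \<chi> (a + poly g s)"]) (auto simp: focused_def)
        then show False using S by simp
      qed
      then have no: "\<not> (\<exists>a\<in>W. \<exists>S\<subseteq>X. card S = Suc (card K) \<and> focused A g \<chi> a S)"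
        if "range \<chi> \<subseteq> K" for \<chi> W X using that by blast
      have T: "thick T" "T \<subseteq> {0<..}" and K: "finite K" using TK by auto
      have p0: "\<forall>p\<in>A. poly p 0 = 0" using less.prems(3) by blast
      obtain W X where WX: "finite W" "finite X" "X \<subseteq> T"
        and foc: "\<forall>\<chi>. range \<chi> \<subseteq> K \<longrightarrow>
          (\<exists>a\<in>W. \<exists>x\<in>X. \<forall>p\<in>A. \<chi> (a + poly p x) = \<chi> a) \<or>
          (\<exists>a\<in>W. \<exists>S\<subseteq>X. card S = Suc (card K) \<and> focused A g \<chi> a S)"
        using focusing_step[OF T K less.prems(1) g(1) p0 IH, of "Suc (card K)"]
        by (elim exE conjE) (rule that)
      have "\<forall>\<chi>. range \<chi> \<subseteq> K \<longrightarrow> (\<exists>a\<in>W. \<exists>x\<in>X. \<forall>p\<in>A. \<chi> (a + poly p x) = \<chi> a)"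
        using foc no by metis
      with WX show "\<exists>W X. finite W \<and> finite X \<and> X \<subseteq> T \<and>
       (\<forall>\<chi>. range \<chi> \<subseteq> K \<longrightarrow> (\<exists>a\<in>W. \<exists>x\<in>X. \<forall>p\<in>A. \<chi> (a + poly p x) = \<chi> a))"
        by (intro exI[of _ W] exI[of _ X] conjI)
    qed
  qed
qed

section \<open>Colour-dependent polynomial recurrence\<close>

text \<open>The colour of \<open>x\<close> is unknown in advance, so the polynomials of all colours
  in \<open>S\<close> are used at once, and the recolouring records where each of these colours
  occurs nearby.\<close>

lemma monochromatic_polynomial_step:
  fixes c :: "int \<Rightarrow> 'c" and f :: "'c \<Rightarrow> int poly"
  assumes "finite (range c)" and f0: "\<And>i. poly (f i) 0 = 0"
  shows "\<exists>x y. x > 0 \<and> y > 0 \<and> y + poly (f (c x)) x > 0 \<and>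
    c y = c x \<and> c (y + poly (f (c x)) x) = c x"
proof -
  define P where "P S = {z. z > 0 \<and> c z \<in> S}" for S
  have "thick (P (range c))"
    unfolding thick_def P_def by (intro allI exI[of _ 1]) auto
  then obtain S where S: "S \<subseteq> range c" "thick (P S)"
    and min: "\<And>S'. S' \<subset> S \<Longrightarrow> \<not> thick (P S')"
  proof -
    let ?F = "{S. S \<subseteq> range c \<and> thick (P S)}"
    have "finite ?F" using assms(1) by (intro finite_subset[of ?F "Pow (range c)"]) auto
    with \<open>thick (P (range c))\<close> obtain S where "S \<in> ?F" "\<forall>S'\<in>?F. S' \<subseteq> S \<longrightarrow> S = S'"
      using finite_has_minimal[of ?F] by blast
    then show thesis by (intro that[of S]) auto
  qed
  have "finite S" using S(1) assms(1) finite_subset by blast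
  \<comment> \<open>Dropping any colour destroys thickness, which bounds the gaps of that
    colour.\<close>
  have "\<exists>n. \<forall>u. \<not> {u..u + int n} \<subseteq> P (S - {i})" if "i \<in> S" for i
    using min[of "S - {i}"] that unfolding thick_def by blast
  then obtain n where n: "\<And>i u. i \<in> S \<Longrightarrow> \<not> {u..u + int (n i)} \<subseteq> P (S - {i})" by metis
  define L where "L = (\<Sum>i\<in>S. n i)"
  have synd: "\<exists>s\<in>{0..int L}. c (u + s) = i" if "i \<in> S" "{u..u + int L} \<subseteq> P S" for i u
  proof -
    have "n i \<le> L" unfolding L_def using that(1) \<open>finite S\<close> by (intro member_le_sum) auto
    then have "{u..u + int (n i)} \<subseteq> {u..u + int L}" by auto
    with n[OF that(1), of u] that(2) obtain z where
      "z \<in> {u..u + int L}" "z \<notin> P (S - {i})" "z \<in> P S" by blast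
    then have "c (u + (z - u)) = i" "z - u \<in> {0..int L}" by (auto simp: P_def)
    then show ?thesis by blast
  qed
  have vdW: "poly_vdW (f ` S - {0})"
    using \<open>finite S\<close> f0 by (intro polynomial_van_der_Waerden) auto
  have pos: "P S \<subseteq> {0<..}" by (auto simp: P_def)
  have fin: "finite (S \<rightarrow>\<^sub>E {0..int L})" using \<open>finite S\<close> by (intro finite_PiE) auto
  obtain W X where WX: "finite W" "finite X" "X \<subseteq> P S"
    and rec: "\<forall>\<psi> :: int \<Rightarrow> 'c \<Rightarrow> int. range \<psi> \<subseteq> (S \<rightarrow>\<^sub>E {0..int L}) \<longrightarrow>
      (\<exists>a\<in>W. \<exists>x\<in>X. \<forall>p\<in>f ` S - {0}. \<psi> (a + poly p x) = \<psi> a)"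
    by (rule poly_vdWE[OF vdW S(2) pos fin])
  define B where "B = W \<union> (\<Union>a\<in>W. \<Union>i\<in>S. \<Union>x\<in>X. {a + poly (f i) x})"
  have finB: "finite B" using WX \<open>finite S\<close> by (auto simp: B_def)
  define m where "m = (\<Sum>b\<in>B. \<bar>b\<bar>)"
  have m: "\<bar>b\<bar> \<le> m" if "b \<in> B" for b
    unfolding m_def using that finB by (intro member_le_sum) auto
  have "m \<ge> 0" by (simp add: m_def sum_nonneg)
  \<comment> \<open>Room for every \<open>u + m + b\<close> with \<open>b\<close> in
    \<open>B\<close>, followed by \<open>L\<close> further points.\<close>
  obtain u where u: "{u..u + int (2 * nat m + L)} \<subseteq> P S"
    using S(2) unfolding thick_def by blast
  have window: "{u + m + b..u + m + b + int L} \<subseteq> P S" if "b \<in> B" for b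
    using m[OF that] \<open>m \<ge> 0\<close> by (intro subset_trans[OF _ u]) auto
  define good where "good z i s \<longleftrightarrow> s \<in> {0..int L} \<and> c (u + m + z + s) = i" for z i s
  \<comment> \<open>Any offset up to \<open>L\<close> will do. The default 0 keeps the values in
    range at positions where no offset exists.\<close>
  define \<psi> where "\<psi> z = restrict (\<lambda>i. if \<exists>s. good z i s then SOME s. good z i s else 0) S" for z
  have good: "good b i (\<psi> b i)" if "b \<in> B" "i \<in> S" for b i
  proof -
    have "\<exists>s. good b i s" using synd[OF that(2) window[OF that(1)]] by (auto simp: good_def)
    then show ?thesis using that(2) by (auto simp: \<psi>_def intro: someI_ex)
  qed
  have "(SOME s. good z i s) \<in> {0..int L}" if "\<exists>s. good z i s" for z i
    using someI_ex[OF that] by (simp add: good_def)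
  then have "range \<psi> \<subseteq> (S \<rightarrow>\<^sub>E {0..int L})" by (auto simp: \<psi>_def)
  from rec[rule_format, OF this] obtain a x where ax: "a \<in> W" "x \<in> X"
    and eq: "\<And>p. p \<in> f ` S - {0} \<Longrightarrow> \<psi> (a + poly p x) = \<psi> a" by blast
  define i where "i = c x"
  have x: "x > 0" "i \<in> S" using ax WX by (auto simp: P_def i_def)
  \<comment> \<open>If \<open>f i\<close> is the removed zero polynomial, both positions
    coincide.\<close>
  have eqi: "\<psi> (a + poly (f i) x) = \<psi> a"
    using eq[of "f i"] x(2) by (cases "f i = 0") auto
  have B: "a \<in> B" "a + poly (f i) x \<in> B" using ax x by (auto simp: B_def)
  \<comment> \<open>Both positions have the same offset to colour \<open>i\<close>, so adding it
    preserves their difference.\<close>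
  define y where "y = u + m + a + \<psi> a i"
  have "y \<in> P S" "c y = i"
    using good[OF B(1) x(2)] window[OF B(1)] by (auto simp: good_def y_def)
  moreover have "y + poly (f i) x \<in> P S" "c (y + poly (f i) x) = i"
    using good[OF B(2) x(2)] window[OF B(2)] unfolding eqi by (auto simp: good_def y_def algebra_simps)
  ultimately show ?thesis using x(1) by (auto simp: P_def i_def)
qed

section \<open>Chains of polynomial configurations\<close>

text \<open>The polynomial used last governs the first step of the chain. Both \<open>y\<close> and
  the sum must lie in the previous stage, so the points lost at a stage are free for its
  polynomial.\<close>

primrec chain_starts :: "(nat \<Rightarrow> int poly) \<Rightarrow> int set \<Rightarrow> nat \<Rightarrow> int set" where
  "chain_starts g E 0 = E"
| "chain_starts g E (Suc n) =
    {x \<in> chain_starts g E n. \<exists>y\<in>chain_starts g E n. y + poly (g n) x \<in> chain_starts g E n}"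

lemma chain_starts_subset: "chain_starts g E n \<subseteq> E"
  by (induction n) auto

lemma chain_startsE:
  assumes "x \<in> chain_starts g E n"
  obtains X Y where "X 0 = x" "\<And>i. i \<le> n \<Longrightarrow> X i \<in> E" "\<And>i. i < n \<Longrightarrow> Y i \<in> E"
    "\<And>i. i < n \<Longrightarrow> Y i = X (Suc i) + poly (g (n - Suc i)) (X i)"
proof -
  have "\<exists>X Y. X 0 = x \<and> (\<forall>i\<le>n. X i \<in> E) \<and> (\<forall>i<n. Y i \<in> E) \<and>
    (\<forall>i<n. Y i = X (Suc i) + poly (g (n - Suc i)) (X i))"
    using assms
  proof (induction n arbitrary: x)
    case 0
    then show ?case by (intro exI[of _ "\<lambda>_. x"]) auto
  next
    case (Suc n)
    then obtain y where x: "x \<in> chain_starts g E n"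
      and y: "y \<in> chain_starts g E n" "y + poly (g n) x \<in> chain_starts g E n" by auto
    from Suc.IH[OF y(1)] obtain X Y where XY: "X 0 = y" "\<forall>i\<le>n. X i \<in> E" "\<forall>i<n. Y i \<in> E"
      "\<forall>i<n. Y i = X (Suc i) + poly (g (n - Suc i)) (X i)" by blast
    show ?case
      \<comment> \<open>Prepending moves the indices by one, in step with
        \<open>g (n - Suc i)\<close>.\<close>
      using XY x y chain_starts_subset[of g E n]
      by (intro exI[of _ "case_nat x X"] exI[of _ "case_nat (y + poly (g n) x) Y"])
        (auto split: nat.split)
  qed
  then show thesis using that by blast
qed

text \<open>Points at which the construction stops after the same number of steps admit no further
  step among themselves, so recolouring by the stopping time contradicts
  the single-step recurrence unless some colour survives.\<close>

lemma chain_starts_nonempty: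
  fixes c :: "int \<Rightarrow> 'c"
  assumes "finite (range c)" "\<And>n. poly (g n) 0 = 0"
  shows "\<exists>\<gamma>. chain_starts g {z. z > 0 \<and> c z = \<gamma>} k \<noteq> {}"
proof (rule ccontr)
  define H where "H z = chain_starts g {w. w > 0 \<and> c w = c z}" for z
  define l where "l z = (LEAST n. z \<notin> H z n)" for z
  assume "\<not> ?thesis"
  then have empty: "z \<notin> H z k" for z by (auto simp: H_def)
  have notin: "z \<notin> H z (l z)" for z unfolding l_def by (rule LeastI[of _ k]) (rule empty)
  have "l z \<le> k" for z unfolding l_def by (rule Least_le) (rule empty)
  then have "range (\<lambda>z. (c z, l z)) \<subseteq> range c \<times> {..k}" by auto
  then have "finite (range (\<lambda>z. (c z, l z)))"
    by (rule finite_subset) (simp add: assms(1))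
  \<comment> \<open>Stopping time \<open>Suc n\<close> means failure at the step with
    \<open>g n\<close>, hence \<open>n - 1\<close>. Time 0 does not occur at the positive
    \<open>x\<close> obtained, since stage 0 contains it.\<close>
  from monochromatic_polynomial_step[OF this, of "\<lambda>(_, n). g (n - 1)"] assms(2)
  obtain x y where xy: "x > 0" "c y = c x" "l y = l x"
    "c (y + poly (g (l x - 1)) x) = c x" "l (y + poly (g (l x - 1)) x) = l x"
    by (auto split: prod.splits)
  have "l x \<noteq> 0"
    using notin[of x] xy(1) by (cases "l x") (auto simp: H_def)
  then obtain n where n: "l x = Suc n" using not0_implies_Suc by blast
  have stage: "z \<in> H x n" if "c z = c x" "l z = l x" for z
  proof -
    have "z \<in> H z n" using not_less_Least[of n "\<lambda>n. z \<notin> H z n"] n that(2) by (auto simp: l_def)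
    then show ?thesis using that(1) by (simp add: H_def)
  qed
  have "x \<in> H x (Suc n)"
    using stage[of x] stage[of y] stage[of "y + poly (g n) x"] xy n by (auto simp: H_def)
  with notin[of x] n show False by simp
qed

theorem corollary1p11:
  fixes k :: nat and f :: "nat \<Rightarrow> int poly" and \<chi> :: "int \<Rightarrow> 'c"
  assumes "k \<ge> 1"
    and "\<And>i. i \<in> {1..k} \<Longrightarrow> poly (f i) 0 = 0"
    and "finite (range \<chi>)"
  shows "\<exists>(x :: nat \<Rightarrow> int) (a :: nat \<Rightarrow> int) \<gamma>.
           (\<forall>i\<in>{0..k}. x i \<noteq> 0 \<and> \<chi> (x i) = \<gamma>) \<and>
           (\<forall>i\<in>{1..k}. a i \<noteq> 0 \<and> \<chi> (a i) = \<gamma>) \<and>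
           (\<forall>i\<in>{1..k}. a i - x i = poly (f i) (x (i - 1)))"
proof -
  \<comment> \<open>Step \<open>i\<close> of the chain uses \<open>g (k - Suc i)\<close>, which has
    to be \<open>f (Suc i)\<close>, hence the reversal. Padding by 0 makes every \<open>g n\<close>
    vanish at 0.\<close>
  define g where "g n = (if n < k then f (k - n) else 0)" for n
  have "poly (g n) 0 = 0" for n using assms(2) by (auto simp: g_def)
  from chain_starts_nonempty[of \<chi> g, OF assms(3) this] obtain \<gamma> x0
    where "x0 \<in> chain_starts g {z. z > 0 \<and> \<chi> z = \<gamma>} k" by blast
  then obtain X Y where XY: "\<And>i. i \<le> k \<Longrightarrow> X i > 0 \<and> \<chi> (X i) = \<gamma>"
    "\<And>i. i < k \<Longrightarrow> Y i > 0 \<and> \<chi> (Y i) = \<gamma>"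
    "\<And>i. i < k \<Longrightarrow> Y i = X (Suc i) + poly (g (k - Suc i)) (X i)"
    by (elim chain_startsE) (auto simp: less_imp_le)
  show ?thesis
  proof (intro exI conjI ballI)
    fix i assume i: "i \<in> {0..k}"
    show "X i \<noteq> 0" "\<chi> (X i) = \<gamma>" using XY(1)[of i] i by auto
  next
    fix i assume i: "i \<in> {1..k}"
    \<comment> \<open>\<open>Y\<close> counts from 0, so \<open>a i\<close> is
      \<open>Y (i - 1)\<close>.\<close>
    then have lt: "i - 1 < k" and Suc: "Suc (i - 1) = i" by auto
    show "Y (i - 1) \<noteq> 0" "\<chi> (Y (i - 1)) = \<gamma>" using XY(2)[OF lt] by auto
    have "g (k - i) = f i" using i by (auto simp: g_def)
    then show "Y (i - 1) - X i = poly (f i) (X (i - 1))" using XY(3)[OF lt] Suc by simp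
  qed
qed

end
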